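(* For any network coding sheaf $F$ on a directed graph $X$, we have the following isomorphisms: $$\bigoplus_vF(v)\cong\bigoplus_eF(e),\qquad H^0(X;F)\cong H^1(X;F),$$ where $v$ ranges over the vertices and $e$ over the edges of $X$.
   Context: $k$ is a field. A directed graph $X$ is given by finite sets $E$ (edges) and $V$ (vertices) with functions $h,t:E\to V$ (head and tail). The incoming edges of $v$ are $in(v)=h^{-1}(v)$ and the outgoing edges are $out(v)=t^{-1}(v)$. A capacity function is a function $c:E\to\mathbb Z_{\ge0}$. A network coding sheaf on $X$ (with capacity $c$) is a cellular sheaf $F$ on $X$ (a vector space for each vertex and edge, and a linear restriction map $\rho_{e,v}:F(v)\to F(e)$ for each incidence of a vertex $v$ with an edge $e$) such that $F(e)=k^{c(e)}$ for each edge and $F(v)=\bigoplus_{e\in in(v)}k^{c(e)}$ for each vertex. The restriction map from $v$ to an incoming edge $e\in in(v)$ is the projection onto the summand $F(e)$. The restriction map from $v$ to an outgoing edge $e\in out(v)$ is an arbitrary linear map $\Phi_{e,v}:F(v)\to F(e)$. $H^0(X;F)$ and $H^1(X;F)$ are the kernel and cokernel of the coboundary map $\bigoplus_vF(v)\to\bigoplus_eF(e)$, whose component at an edge $e$ is $\rho_{e,h(e)}-\rho_{e,t(e)}$ (up to sign, depending on a local orientation of $e$). *)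

theory Defs
  imports "HOL-Algebra.AbelCoset" "Graph_Theory.Digraph" "Jordan_Normal_Form.VS_Connect"
begin

section \<open>Vector spaces\<close>

text \<open>As usual for modules in HOL-Algebra, the multiplicative fields of the record are irrelevant.\<close>

definition family_sum ::
  "'i set \<Rightarrow> ('i \<Rightarrow> ('k, 'x, 'm) module_scheme) \<Rightarrow> ('k, 'i \<Rightarrow> 'x) module" where
  "family_sum I M =
    \<lparr>carrier = {x \<in> \<Pi>\<^sub>E i\<in>I. carrier (M i). finite {i \<in> I. x i \<noteq> \<zero>\<^bsub>M i\<^esub>}},
     mult = undefined,
     one = undefined,
     zero = (\<lambda>i\<in>I. \<zero>\<^bsub>M i\<^esub>),
     add = (\<lambda>x y. \<lambda>i\<in>I. x i \<oplus>\<^bsub>M i\<^esub> y i),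
     smult = (\<lambda>a x. \<lambda>i\<in>I. a \<odot>\<^bsub>M i\<^esub> x i)\<rparr>"

text \<open>Scalar multiplication sends the coset \<open>N + x\<close> to \<open>N + a x\<close>.  The union makes this
  independent of a choice of representative, also when \<open>a = 0\<close>.\<close>

definition quotient_space ::
  "('k, 'x, 'm) module_scheme \<Rightarrow> 'x set \<Rightarrow> ('k, 'x set) module" where
  "quotient_space M N =
    \<lparr>carrier = a_rcosets\<^bsub>M\<^esub> N,
     mult = undefined,
     one = undefined,
     zero = N,
     add = set_add M,
     smult = (\<lambda>a X. \<Union>x\<in>X. N +>\<^bsub>M\<^esub> (a \<odot>\<^bsub>M\<^esub> x))\<rparr>"

definition vs_isomorphic ::
  "('k, 'r) ring_scheme \<Rightarrow> ('k, 'x, 'm) module_scheme \<Rightarrow> ('k, 'y, 'n) module_scheme \<Rightarrow> bool" where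
  "vs_isomorphic K V W \<longleftrightarrow> (\<exists>f. linear_map K V W f \<and> bij_betw f (carrier V) (carrier W))"


section \<open>Cellular sheaves on directed graphs\<close>

text \<open>The incidences of vertices with edges are indexed by the two ends of each edge, so that a loop
  has two incidences with its vertex, each with its own restriction map.\<close>

record ('v, 'e, 'k, 'x, 'y) graph_sheaf =
  vertex_stalk :: "'v \<Rightarrow> ('k, 'x) module"
  edge_stalk :: "'e \<Rightarrow> ('k, 'y) module"
  restr_head :: "'e \<Rightarrow> 'x \<Rightarrow> 'y"
  restr_tail :: "'e \<Rightarrow> 'x \<Rightarrow> 'y"

locale cellular_sheaf = fin_digraph G
  for K :: "('k, 'r) ring_scheme"
    and G :: "('v, 'e) pre_digraph"
    and F :: "('v, 'e, 'k, 'x, 'y) graph_sheaf" +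
  assumes vectorspace_vertex_stalk: "v \<in> verts G \<Longrightarrow> vectorspace K (vertex_stalk F v)"
    and vectorspace_edge_stalk: "e \<in> arcs G \<Longrightarrow> vectorspace K (edge_stalk F e)"
    and linear_restr_head:
      "e \<in> arcs G \<Longrightarrow> linear_map K (vertex_stalk F (head G e)) (edge_stalk F e) (restr_head F e)"
    and linear_restr_tail:
      "e \<in> arcs G \<Longrightarrow> linear_map K (vertex_stalk F (tail G e)) (edge_stalk F e) (restr_tail F e)"

definition cochains0 ::
  "('v, 'e) pre_digraph \<Rightarrow> ('v, 'e, 'k, 'x, 'y) graph_sheaf \<Rightarrow> ('k, 'v \<Rightarrow> 'x) module" where
  "cochains0 G F = family_sum (verts G) (vertex_stalk F)"

definition cochains1 ::
  "('v, 'e) pre_digraph \<Rightarrow> ('v, 'e, 'k, 'x, 'y) graph_sheaf \<Rightarrow> ('k, 'e \<Rightarrow> 'y) module" where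
  "cochains1 G F = family_sum (arcs G) (edge_stalk F)"

text \<open>The scalar \<open>\<epsilon> e\<close>, which is \<open>1\<close> or \<open>-1\<close>, is the sign determined by the local
  orientation of the edge \<open>e\<close>.\<close>

definition coboundary ::
  "('v, 'e) pre_digraph \<Rightarrow> ('v, 'e, 'k, 'x, 'y) graph_sheaf \<Rightarrow> ('e \<Rightarrow> 'k) \<Rightarrow> ('v \<Rightarrow> 'x) \<Rightarrow> 'e \<Rightarrow> 'y"
  where
  "coboundary G F \<epsilon> x =
    (\<lambda>e\<in>arcs G. \<epsilon> e \<odot>\<^bsub>edge_stalk F e\<^esub>
      (restr_head F e (x (head G e)) \<ominus>\<^bsub>edge_stalk F e\<^esub> restr_tail F e (x (tail G e))))"

definition cohomology0 ::
  "('v, 'e) pre_digraph \<Rightarrow> ('v, 'e, 'k, 'x, 'y) graph_sheaf \<Rightarrow> ('e \<Rightarrow> 'k) \<Rightarrow> ('k, 'v \<Rightarrow> 'x) module"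
  where
  "cohomology0 G F \<epsilon> =
    (cochains0 G F)\<lparr>carrier := mod_hom.ker (cochains0 G F) (cochains1 G F) (coboundary G F \<epsilon>)\<rparr>"

definition cohomology1 ::
  "('v, 'e) pre_digraph \<Rightarrow> ('v, 'e, 'k, 'x, 'y) graph_sheaf \<Rightarrow> ('e \<Rightarrow> 'k) \<Rightarrow> ('k, ('e \<Rightarrow> 'y) set) module"
  where
  "cohomology1 G F \<epsilon> =
    quotient_space (cochains1 G F) (mod_hom.im (cochains0 G F) (coboundary G F \<epsilon>))"


section \<open>Network coding sheaves\<close>

text \<open>The restriction map to an outgoing edge is only required to be linear, which is part of
  \<open>cellular_sheaf\<close>.\<close>

locale network_coding_sheaf = cellular_sheaf class_ring G F
  for G :: "('v, 'e) pre_digraph"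
    and c :: "'e \<Rightarrow> nat"
    and F :: "('v, 'e, 'k :: field, 'e \<Rightarrow> 'k vec, 'k vec) graph_sheaf" +
  assumes edge_stalk_eq: "e \<in> arcs G \<Longrightarrow> edge_stalk F e = module_vec TYPE('k) (c e)"
    and vertex_stalk_eq:
      "v \<in> verts G \<Longrightarrow> vertex_stalk F v = family_sum (in_arcs G v) (\<lambda>e. module_vec TYPE('k) (c e))"
    and restr_head_eq:
      "\<lbrakk>e \<in> arcs G; x \<in> carrier (vertex_stalk F (head G e))\<rbrakk> \<Longrightarrow> restr_head F e x = x e"

end

theory Submission
  imports Defs
begin

text \<open>Every edge has exactly one head, so collecting the summands of all \<open>F(v)\<close> permutes the
  summands \<open>F(e)\<close>, which gives the first isomorphism.  Hence the coboundary is a linear map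
  between spaces of the same finite dimension, and by rank-nullity its kernel and its cokernel
  have the same dimension.\<close>

section \<open>Vector spaces up to isomorphism\<close>

lemma linear_mapI:
  assumes "vectorspace K V" "vectorspace K W"
    and "\<And>x. x \<in> carrier V \<Longrightarrow> f x \<in> carrier W"
    and "\<And>x y. \<lbrakk>x \<in> carrier V; y \<in> carrier V\<rbrakk> \<Longrightarrow> f (x \<oplus>\<^bsub>V\<^esub> y) = f x \<oplus>\<^bsub>W\<^esub> f y"
    and "\<And>a x. \<lbrakk>a \<in> carrier K; x \<in> carrier V\<rbrakk> \<Longrightarrow> f (a \<odot>\<^bsub>V\<^esub> x) = a \<odot>\<^bsub>W\<^esub> f x"
  shows "linear_map K V W f"
proof -
  have "Module.module K V" "Module.module K W"
    using assms(1,2) by (simp_all add: vectorspace_def)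
  then have "mod_hom K V W f"
    using assms by (auto simp: mod_hom_def mod_hom_axioms_def module_hom_def)
  then show ?thesis
    using assms(1,2) by (simp add: linear_map_def)
qed

lemma vs_isomorphic_sym:
  assumes "vs_isomorphic K V W"
  shows "vs_isomorphic K W V"
proof -
  obtain f where f: "linear_map K V W f" and b: "bij_betw f (carrier V) (carrier W)"
    using assms by (auto simp: vs_isomorphic_def)
  interpret linear_map K V W f by (rule f)
  let ?g = "the_inv_into (carrier V) f"
  have inj: "inj_on f (carrier V)" and im: "f ` carrier V = carrier W"
    using b by (auto simp: bij_betw_def)
  have g: "?g y \<in> carrier V" "f (?g y) = y" if "y \<in> carrier W" for y
    using that the_inv_into_into[OF inj, of y "carrier V"] f_the_inv_into_f[OF inj, of y] im by auto
  \<comment> \<open>Uniqueness of preimages turns each linearity law for \<open>?g\<close> into the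
    corresponding law for \<open>f\<close>, which is known.\<close>
  have eq: "?g y = x" if "x \<in> carrier V" "f x = y" for x y
    using that the_inv_into_f_f[OF inj] by auto
  have "linear_map K W V ?g"
  proof (rule linear_mapI)
    show "vectorspace K W" "vectorspace K V" by unfold_locales
  qed (auto simp: g intro!: eq)
  moreover have "bij_betw ?g (carrier W) (carrier V)"
    by (rule bij_betw_the_inv_into[OF b])
  ultimately show ?thesis by (auto simp: vs_isomorphic_def)
qed

lemma vs_isomorphic_trans:
  assumes "vs_isomorphic K U V" "vs_isomorphic K V W"
  shows "vs_isomorphic K U W"
proof -
  obtain f g where f: "linear_map K U V f" "bij_betw f (carrier U) (carrier V)"
    and g: "linear_map K V W g" "bij_betw g (carrier V) (carrier W)"
    using assms by (auto simp: vs_isomorphic_def)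
  interpret f: linear_map K U V f by (rule f)
  interpret g: linear_map K V W g by (rule g)
  have "linear_map K U W (g \<circ> f)"
  proof (rule linear_mapI)
    show "vectorspace K U" "vectorspace K W" by unfold_locales
  qed auto
  then show ?thesis
    using bij_betw_trans[OF f(2) g(2)] by (auto simp: vs_isomorphic_def)
qed

section \<open>Coordinate spaces and classification by dimension\<close>

context vectorspace
begin

text \<open>Every vector has exactly one family of coordinates in a finite basis, so forming linear
  combinations is a bijection from coordinate families to vectors.\<close>

lemma basis_isomorphic_func_space:
  assumes "finite B" "basis B"
  shows "vs_isomorphic K (func_space B) V"
proof -
  have B: "B \<subseteq> carrier V" using assms by (simp add: basis_def)
  have u: "\<exists>!a. a \<in> B \<rightarrow>\<^sub>E carrier K \<and> lincomb a B = v" if "v \<in> carrier V" for v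
    using basis_criterion[OF assms(1) B] assms(2) that by blast
  have "bij_betw (\<lambda>a. lincomb a B) (B \<rightarrow>\<^sub>E carrier K) (carrier V)"
  proof (rule bij_betwI')
    fix a b assume ab: "a \<in> B \<rightarrow>\<^sub>E carrier K" "b \<in> B \<rightarrow>\<^sub>E carrier K"
    then have "lincomb a B \<in> carrier V" using B by (intro lincomb_closed) auto
    then show "(lincomb a B = lincomb b B) = (a = b)" using u ab by metis
  next
    fix a assume "a \<in> B \<rightarrow>\<^sub>E carrier K"
    then show "lincomb a B \<in> carrier V" using B by (intro lincomb_closed) auto
  next
    fix v assume "v \<in> carrier V"
    then show "\<exists>a\<in>B \<rightarrow>\<^sub>E carrier K. v = lincomb a B" using u by metis
  qed
  moreover have "linear_map K (func_space B) V (\<lambda>a. lincomb a B)"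
    by (rule lincomb_is_linear[OF assms(1) B])
  ultimately show ?thesis by (auto simp: vs_isomorphic_def func_space_def)
qed

text \<open>Precomposition with \<open>h\<close> is linear and is inverted by precomposition with
  the inverse of \<open>h\<close>. It reverses direction: a map from \<open>A\<close> to
  \<open>B\<close> sends families on \<open>B\<close> to families on \<open>A\<close>.\<close>

lemma func_space_reindex:
  assumes h: "bij_betw h A B"
  shows "vs_isomorphic K (func_space B) (func_space A)"
proof -
  \<comment> \<open>The restrictions keep both results extensional, as membership in
    \<open>A \<rightarrow>\<^sub>E carrier K\<close> and
    \<open>B \<rightarrow>\<^sub>E carrier K\<close> demands.\<close>
  let ?f = "\<lambda>b. \<lambda>i\<in>A. b (h i)" and ?g = "\<lambda>a. \<lambda>j\<in>B. a (inv_into A h j)"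
  have hB: "h i \<in> B" if "i \<in> A" for i using h that by (auto simp: bij_betw_def)
  have "linear_map K (func_space B) (func_space A) ?f"
    by (rule linear_mapI) (auto simp: func_space_is_vs, auto simp: func_space_def hB fun_eq_iff)
  moreover have "bij_betw ?f (B \<rightarrow>\<^sub>E carrier K) (A \<rightarrow>\<^sub>E carrier K)"
  proof (rule bij_betw_byWitness[where f' = ?g])
    show "\<forall>b\<in>B \<rightarrow>\<^sub>E carrier K. ?g (?f b) = b"
      using h by (auto simp: fun_eq_iff bij_betw_def f_inv_into_f inv_into_into PiE_def extensional_def)
    show "\<forall>a\<in>A \<rightarrow>\<^sub>E carrier K. ?f (?g a) = a"
      using h by (auto simp: fun_eq_iff bij_betw_def PiE_def extensional_def)
    show "?f ` (B \<rightarrow>\<^sub>E carrier K) \<subseteq> A \<rightarrow>\<^sub>E carrier K" using hB by auto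
    show "?g ` (A \<rightarrow>\<^sub>E carrier K) \<subseteq> B \<rightarrow>\<^sub>E carrier K"
      using h by (auto simp: bij_betw_def inv_into_into)
  qed
  ultimately show ?thesis by (auto simp: vs_isomorphic_def func_space_def)
qed

end

text \<open>Passes from \<open>V\<close> to its coordinate space, along a bijection of two bases to
  the coordinate space of \<open>W\<close>, and from there to \<open>W\<close>.\<close>

lemma vs_isomorphic_if_dim_eq:
  assumes V: "vectorspace K V" "vectorspace.fin_dim K V"
    and W: "vectorspace K W" "vectorspace.fin_dim K W"
    and dim: "vectorspace.dim K V = vectorspace.dim K W"
  shows "vs_isomorphic K V W"
proof -
  interpret V: vectorspace K V by (rule V)
  interpret W: vectorspace K W by (rule W)
  obtain A where A: "finite A" "V.basis A" using V.finite_basis_exists[OF V(2)] by blast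
  obtain B where B: "finite B" "W.basis B" using W.finite_basis_exists[OF W(2)] by blast
  have "card A = card B" using V.dim_basis[OF A] W.dim_basis[OF B] dim by simp
  \<comment> \<open>The bijection goes from the basis of \<open>W\<close> to that of
    \<open>V\<close>, since reindexing reverses direction.\<close>
  then obtain h where h: "bij_betw h B A"
    using A(1) B(1) finite_same_card_bij by metis
  show ?thesis
    using vs_isomorphic_trans[OF vs_isomorphic_sym[OF V.basis_isomorphic_func_space[OF A]]
        vs_isomorphic_trans[OF V.func_space_reindex[OF h] W.basis_isomorphic_func_space[OF B]]] .
qed

text \<open>Surjectivity carries finite dimension over to \<open>W\<close>; bijectivity then equates
  the dimensions.\<close>

lemma
  assumes "vs_isomorphic K V W" "vectorspace.fin_dim K V"
  shows vs_isomorphic_fin_dim: "vectorspace.fin_dim K W"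
    and vs_isomorphic_dim_eq: "vectorspace.dim K V = vectorspace.dim K W"
proof -
  obtain f where f: "linear_map K V W f" "bij_betw f (carrier V) (carrier W)"
    using assms(1) by (auto simp: vs_isomorphic_def)
  interpret linear_map K V W f by (rule f)
  show "W.fin_dim" "V.dim = W.dim"
    using surj_fin_dim[OF assms(2)] dim_eq[OF assms(2)] f(2) by (auto simp: bij_betw_def)
qed

text \<open>Independence in \<open>N\<close> agrees with independence in \<open>V\<close>, so
  \<open>dim\<close> bounds the size of independent subsets of \<open>N\<close>; a maximal one is a
  finite basis of \<open>N\<close>.\<close>

lemma (in vectorspace) fin_dim_subspace:
  assumes "VectorSpace.subspace K N V" "fin_dim"
  shows "vectorspace.fin_dim K (vs N)"
proof -
  interpret N: vectorspace K "vs N" by (rule subspace_is_vs[OF assms(1)])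
  have sub: "submodule K N V" using assms(1) by simp
  then have N: "N \<subseteq> carrier V" by (simp add: submodule_def)
  have "finite A \<and> card A \<le> dim" if "A \<subseteq> N \<and> N.lin_indpt A" for A
    using that span_li_not_depend(2)[OF _ sub, of A] li_le_dim[OF assms(2), of A] N by auto
  \<comment> \<open>The empty set is the starting point from which a maximal independent set is
    reached.\<close>
  moreover have "{} \<subseteq> N \<and> N.lin_indpt {}" by (auto simp: N.lin_dep_def)
  ultimately obtain A where "finite A" "maximal A (\<lambda>A. A \<subseteq> N \<and> N.lin_indpt A)"
    using maximal_exists[of "\<lambda>A. A \<subseteq> N \<and> N.lin_indpt A" dim "{}"] by blast
  then have "N.basis A" by (intro N.max_li_is_basis) simp
  then show ?thesis using \<open>finite A\<close> by (auto simp: N.fin_dim_def N.basis_def)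
qed

section \<open>Quotient spaces\<close>

context vectorspace
begin

context
  fixes N
  assumes N: "submodule K N V"
begin

interpretation N: submodule K N V by (rule N)

text \<open>Makes the theory of additive cosets available for \<open>N\<close>. Closure under
  negation comes from multiplication by the scalar -1.\<close>

lemma submodule_abelian_subgroup: "abelian_subgroup N V"
proof (rule abelian_subgroupI3)
  show "abelian_group V" by unfold_locales
  have "\<ominus>\<^bsub>V\<^esub> x \<in> N" if "x \<in> N" for x
  proof -
    have "x \<in> carrier V" using N.subset that by blast
    then have "\<ominus>\<^bsub>V\<^esub> x = (\<ominus>\<^bsub>K\<^esub> \<one>\<^bsub>K\<^esub>) \<odot>\<^bsub>V\<^esub> x" by (simp add: smult_minus_1)
    then show ?thesis using that by simp
  qed
  then have "subgroup N (add_monoid V)"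
    using N.subset by unfold_locales (auto simp: a_inv_def[symmetric])
  then show "additive_subgroup N V" by (rule additive_subgroup.intro)
qed

interpretation S: abelian_subgroup N V by (rule submodule_abelian_subgroup)

lemma carrier_quotient_space:
  "carrier (quotient_space V N) = (\<lambda>x. N +>\<^bsub>V\<^esub> x) ` carrier V"
  by (auto simp: quotient_space_def A_RCOSETS_def')

text \<open>Gives zero a representative, so that laws of the quotient involving it reduce to laws in
  \<open>V\<close>.\<close>

lemma zero_quotient_space: "\<zero>\<^bsub>quotient_space V N\<^esub> = N +>\<^bsub>V\<^esub> \<zero>\<^bsub>V\<^esub>"
  by (simp add: quotient_space_def a_coset_add_zero N.subset)

lemma add_quotient_space:
  "\<lbrakk>x \<in> carrier V; y \<in> carrier V\<rbrakk> \<Longrightarrow>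
    (N +>\<^bsub>V\<^esub> x) \<oplus>\<^bsub>quotient_space V N\<^esub> (N +>\<^bsub>V\<^esub> y) = N +>\<^bsub>V\<^esub> (x \<oplus>\<^bsub>V\<^esub> y)"
  by (simp add: quotient_space_def S.a_rcos_sum)

lemma coset_mem_iff:
  "\<lbrakk>x \<in> carrier V; y \<in> carrier V\<rbrakk> \<Longrightarrow> y \<in> N +>\<^bsub>V\<^esub> x \<longleftrightarrow> y \<ominus>\<^bsub>V\<^esub> x \<in> N"
  by (simp add: S.a_rcos_module a_minus_def)

lemma coset_eq_iff:
  assumes "x \<in> carrier V" "y \<in> carrier V"
  shows "N +>\<^bsub>V\<^esub> x = N +>\<^bsub>V\<^esub> y \<longleftrightarrow> y \<ominus>\<^bsub>V\<^esub> x \<in> N"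
proof
  assume "N +>\<^bsub>V\<^esub> x = N +>\<^bsub>V\<^esub> y"
  then have "y \<in> N +>\<^bsub>V\<^esub> x" by (rule S.a_repr_independenceD[OF assms(2)])
  then show "y \<ominus>\<^bsub>V\<^esub> x \<in> N" using coset_mem_iff[OF assms] by blast
next
  assume "y \<ominus>\<^bsub>V\<^esub> x \<in> N"
  then have "y \<in> N +>\<^bsub>V\<^esub> x" using coset_mem_iff[OF assms] by blast
  then show "N +>\<^bsub>V\<^esub> x = N +>\<^bsub>V\<^esub> y" using assms(1) by (rule S.a_repr_independence')
qed

text \<open>If \<open>y\<close> represents the coset of \<open>x\<close>, then \<open>a\<close>
  times their difference lies in \<open>N\<close>. All cosets in the defining union therefore
  coincide.\<close>

lemma smult_quotient_space:
  assumes a: "a \<in> carrier K" and x: "x \<in> carrier V"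
  shows "a \<odot>\<^bsub>quotient_space V N\<^esub> (N +>\<^bsub>V\<^esub> x) = N +>\<^bsub>V\<^esub> (a \<odot>\<^bsub>V\<^esub> x)"
proof -
  have eq: "N +>\<^bsub>V\<^esub> (a \<odot>\<^bsub>V\<^esub> y) = N +>\<^bsub>V\<^esub> (a \<odot>\<^bsub>V\<^esub> x)" if "y \<in> N +>\<^bsub>V\<^esub> x" for y
  proof -
    have y: "y \<in> carrier V" using that x by (rule S.a_elemrcos_carrier[rotated])
    then have "x \<ominus>\<^bsub>V\<^esub> y \<in> N"
      using S.a_repr_independence'[OF that x] coset_eq_iff[OF y x] by simp
    moreover have "a \<odot>\<^bsub>V\<^esub> (x \<ominus>\<^bsub>V\<^esub> y) = a \<odot>\<^bsub>V\<^esub> x \<ominus>\<^bsub>V\<^esub> a \<odot>\<^bsub>V\<^esub> y"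
      using a x y by (simp add: a_minus_def smult_r_distr smult_r_minus)
    ultimately show ?thesis using N.smult_closed[OF a] a x y by (metis coset_eq_iff smult_closed)
  qed
  have "(\<Union>y\<in>N +>\<^bsub>V\<^esub> x. N +>\<^bsub>V\<^esub> (a \<odot>\<^bsub>V\<^esub> y)) = (\<Union>y\<in>N +>\<^bsub>V\<^esub> x. N +>\<^bsub>V\<^esub> (a \<odot>\<^bsub>V\<^esub> x))"
    by (intro SUP_cong refl eq)
  \<comment> \<open>A union of equal sets is that set only over a nonempty index set.\<close>
  moreover have "N +>\<^bsub>V\<^esub> x \<noteq> {}" using S.a_rcos_self[OF x] by blast
  ultimately show ?thesis by (simp add: quotient_space_def)
qed

lemma vectorspace_quotient_space: "vectorspace K (quotient_space V N)"
proof -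
  let ?Q = "quotient_space V N"
  note simps = add_quotient_space zero_quotient_space
  have rep: "\<exists>x\<in>carrier V. X = N +>\<^bsub>V\<^esub> x" if "X \<in> carrier ?Q" for X
    using that by (auto simp: carrier_quotient_space)
  have mem: "N +>\<^bsub>V\<^esub> x \<in> carrier ?Q" if "x \<in> carrier V" for x
    using that by (simp add: carrier_quotient_space)
  have "abelian_group ?Q"
  proof (rule abelian_groupI)
    show "\<zero>\<^bsub>?Q\<^esub> \<in> carrier ?Q"
      unfolding zero_quotient_space by (rule mem) simp
    fix X assume "X \<in> carrier ?Q"
    then obtain x where x: "x \<in> carrier V" "X = N +>\<^bsub>V\<^esub> x" using rep by blast
    show "\<zero>\<^bsub>?Q\<^esub> \<oplus>\<^bsub>?Q\<^esub> X = X"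
      \<comment> \<open>The deleted rule would collapse the coset of zero back to \<open>N\<close>,
        and \<open>add_quotient_space\<close> would no longer match.\<close>
      unfolding zero_quotient_space using x(1) by (simp add: x(2) add_quotient_space del: a_coset_add_zero)
    show "\<exists>Y\<in>carrier ?Q. Y \<oplus>\<^bsub>?Q\<^esub> X = \<zero>\<^bsub>?Q\<^esub>"
      using x(1) by (intro bexI[of _ "N +>\<^bsub>V\<^esub> (\<ominus>\<^bsub>V\<^esub> x)"] mem) (simp_all add: x(2) simps M.l_neg)
    fix Y assume "Y \<in> carrier ?Q"
    then obtain y where y: "y \<in> carrier V" "Y = N +>\<^bsub>V\<^esub> y" using rep by blast
    show "X \<oplus>\<^bsub>?Q\<^esub> Y \<in> carrier ?Q"
      using x(1) y(1) by (simp add: x(2) y(2) add_quotient_space mem)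
    show "X \<oplus>\<^bsub>?Q\<^esub> Y = Y \<oplus>\<^bsub>?Q\<^esub> X"
      using x(1) y(1) by (simp add: x(2) y(2) add_quotient_space M.a_comm)
    fix Z assume "Z \<in> carrier ?Q"
    then obtain z where z: "z \<in> carrier V" "Z = N +>\<^bsub>V\<^esub> z" using rep by blast
    show "(X \<oplus>\<^bsub>?Q\<^esub> Y) \<oplus>\<^bsub>?Q\<^esub> Z = X \<oplus>\<^bsub>?Q\<^esub> (Y \<oplus>\<^bsub>?Q\<^esub> Z)"
      using x(1) y(1) z(1) by (simp add: x(2) y(2) z(2) add_quotient_space M.a_assoc)
  qed
  then have "Module.module K ?Q"
  proof (rule moduleI[rotated])
    show "cring K" by unfold_locales
    fix X assume "X \<in> carrier ?Q"
    then obtain x where x: "x \<in> carrier V" "X = N +>\<^bsub>V\<^esub> x" using rep by blast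
    show "\<one>\<^bsub>K\<^esub> \<odot>\<^bsub>?Q\<^esub> X = X"
      using x(1) by (simp add: x(2) smult_quotient_space)
    fix a assume a: "a \<in> carrier K"
    show "a \<odot>\<^bsub>?Q\<^esub> X \<in> carrier ?Q"
      using x(1) a by (simp add: x(2) smult_quotient_space mem)
    show "a \<odot>\<^bsub>?Q\<^esub> (X \<oplus>\<^bsub>?Q\<^esub> Y) = a \<odot>\<^bsub>?Q\<^esub> X \<oplus>\<^bsub>?Q\<^esub> a \<odot>\<^bsub>?Q\<^esub> Y" if Y: "Y \<in> carrier ?Q" for Y
    proof -
      obtain y where y: "y \<in> carrier V" "Y = N +>\<^bsub>V\<^esub> y" using rep[OF Y] by blast
      then show ?thesis
        using x(1) a by (simp add: x(2) add_quotient_space smult_quotient_space smult_r_distr)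
    qed
    fix b assume b: "b \<in> carrier K"
    show "(a \<oplus>\<^bsub>K\<^esub> b) \<odot>\<^bsub>?Q\<^esub> X = a \<odot>\<^bsub>?Q\<^esub> X \<oplus>\<^bsub>?Q\<^esub> b \<odot>\<^bsub>?Q\<^esub> X"
      using x(1) a b by (simp add: x(2) add_quotient_space smult_quotient_space smult_l_distr)
    show "(a \<otimes>\<^bsub>K\<^esub> b) \<odot>\<^bsub>?Q\<^esub> X = a \<odot>\<^bsub>?Q\<^esub> (b \<odot>\<^bsub>?Q\<^esub> X)"
      using x(1) a b by (simp add: x(2) smult_quotient_space smult_assoc1)
  qed
  then show ?thesis by (simp add: vectorspace_def field_axioms)
qed

lemma linear_map_quotient_space: "linear_map K V (quotient_space V N) (\<lambda>x. N +>\<^bsub>V\<^esub> x)"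
  by (rule linear_mapI)
    (auto simp: vectorspace_quotient_space vectorspace_axioms carrier_quotient_space
      add_quotient_space smult_quotient_space)

text \<open>Rank-nullity for the projection, which is surjective with kernel
  \<open>N\<close>.\<close>

lemma dim_quotient_space:
  assumes "fin_dim"
  shows "vectorspace.fin_dim K (quotient_space V N)"
    and "vectorspace.dim K (quotient_space V N) + vectorspace.dim K (vs N) = dim"
proof -
  interpret p: linear_map K V "quotient_space V N" "\<lambda>x. N +>\<^bsub>V\<^esub> x"
    by (rule linear_map_quotient_space)
  have surj: "(\<lambda>x. N +>\<^bsub>V\<^esub> x) ` carrier V = carrier (quotient_space V N)"
    by (simp add: carrier_quotient_space)
  show "vectorspace.fin_dim K (quotient_space V N)" by (rule p.surj_fin_dim[OF assms surj])
  have "p.kerT = N"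
  proof -
    have "N +>\<^bsub>V\<^esub> x = N \<longleftrightarrow> x \<in> N" if "x \<in> carrier V" for x
      using a_coset_join1[OF _ that S.a_subgroup] S.a_rcos_const by blast
    moreover have "\<zero>\<^bsub>quotient_space V N\<^esub> = N" by (simp add: quotient_space_def)
    ultimately show ?thesis using N.subset unfolding p.ker_def by blast
  qed
  moreover have "p.imT = carrier (quotient_space V N)" by (rule p.surj_imp_imT_carrier[OF surj])
  ultimately show "vectorspace.dim K (quotient_space V N) + vectorspace.dim K (vs N) = dim"
    using p.rank_nullity[OF assms] by simp
qed

end

end

text \<open>The rank plus the dimension of the kernel is the dimension of \<open>V\<close>; the rank
  plus the dimension of the cokernel is that of \<open>W\<close>. These totals agree, and the rank
  cancels.\<close>

lemma (in linear_map) ker_isomorphic_coker: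
  assumes "V.fin_dim" "vs_isomorphic K V W"
  shows "vs_isomorphic K (V.vs kerT) (quotient_space W imT)"
proof (rule vs_isomorphic_if_dim_eq)
  have W: "W.fin_dim" "V.dim = W.dim"
    using vs_isomorphic_fin_dim vs_isomorphic_dim_eq assms by blast+
  show "vectorspace K (V.vs kerT)" by (rule V.subspace_is_vs[OF kerT_is_subspace])
  show "vectorspace.fin_dim K (V.vs kerT)"
    by (rule V.fin_dim_subspace[OF kerT_is_subspace assms(1)])
  show "vectorspace K (quotient_space W imT)"
    by (rule W.vectorspace_quotient_space[OF im_is_submodule])
  show "vectorspace.fin_dim K (quotient_space W imT)"
    by (rule W.dim_quotient_space[OF im_is_submodule W(1)])
  show "vectorspace.dim K (V.vs kerT) = vectorspace.dim K (quotient_space W imT)"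
    using W.dim_quotient_space(2)[OF im_is_submodule W(1)] rank_nullity[OF assms(1)] W(2) by simp
qed

lemma (in linear_map) image_span_subset:
  assumes A: "A \<subseteq> carrier V"
  shows "T ` V.module.span A \<subseteq> W.module.span (T ` A)"
proof -
  have TA: "T ` A \<subseteq> carrier W" using A by auto
  interpret S: submodule K "W.module.span (T ` A)" W by (rule W.module.span_is_submodule[OF TA])
  let ?P = "{x \<in> carrier V. T x \<in> W.module.span (T ` A)}"
  have "submodule K ?P V"
    by unfold_locales auto
  moreover have "A \<subseteq> ?P" using A W.module.in_own_span[OF TA] by auto
  ultimately show ?thesis using V.module.span_is_subset by blast
qed

section \<open>Finite direct sums\<close>

text \<open>Every family over a finite index set has finite support.\<close>

lemma carrier_family_sum:
  "finite I \<Longrightarrow> carrier (family_sum I M) = (\<Pi>\<^sub>E i\<in>I. carrier (M i))"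
  by (auto simp: family_sum_def)

lemma family_sum_simps:
  "\<zero>\<^bsub>family_sum I M\<^esub> = (\<lambda>i\<in>I. \<zero>\<^bsub>M i\<^esub>)"
  "x \<oplus>\<^bsub>family_sum I M\<^esub> y = (\<lambda>i\<in>I. x i \<oplus>\<^bsub>M i\<^esub> y i)"
  "a \<odot>\<^bsub>family_sum I M\<^esub> x = (\<lambda>i\<in>I. a \<odot>\<^bsub>M i\<^esub> x i)"
  by (simp_all add: family_sum_def)

text \<open>The canonical injection of the \<open>j\<close>-th summand into the direct sum.\<close>

definition family_single ::
  "'i set \<Rightarrow> ('i \<Rightarrow> ('k, 'x, 'm) module_scheme) \<Rightarrow> 'i \<Rightarrow> 'x \<Rightarrow> 'i \<Rightarrow> 'x" where
  "family_single I M j x = (\<lambda>i\<in>I. if i = j then x else \<zero>\<^bsub>M i\<^esub>)"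

context
  fixes K :: "('k, 'r) ring_scheme" and I :: "'i set" and M :: "'i \<Rightarrow> ('k, 'x, 'm) module_scheme"
  assumes K: "field K" and I: "finite I" and M: "\<And>i. i \<in> I \<Longrightarrow> vectorspace K (M i)"
begin

private lemma component_module: "i \<in> I \<Longrightarrow> Module.module K (M i)"
  using M by (simp add: vectorspace_def)

private lemma component_group: "i \<in> I \<Longrightarrow> abelian_group (M i)"
  using component_module by (simp add: module_def)

private lemma component_monoid: "i \<in> I \<Longrightarrow> abelian_monoid (M i)"
  using component_group by (simp add: abelian_group_def)

text \<open>Module laws of the summands as rules conditional on \<open>i \<in> I\<close>; the direct
  sum inherits its laws from them componentwise.\<close>

private lemmas components =
  abelian_monoid.zero_closed[OF component_monoid]
  abelian_monoid.a_closed[OF component_monoid]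
  abelian_monoid.l_zero[OF component_monoid]
  abelian_monoid.r_zero[OF component_monoid]
  abelian_monoid.a_assoc[OF component_monoid]
  abelian_monoid.a_comm[OF component_monoid]
  abelian_monoid.a_lcomm[OF component_monoid]
  abelian_group.a_inv_closed[OF component_group]
  abelian_group.r_neg[OF component_group]
  module.smult_closed[OF component_module]
  module.smult_one[OF component_module]
  module.smult_l_distr[OF component_module]
  module.smult_r_distr[OF component_module]
  module.smult_assoc1[OF component_module]
  module.rmult_0[OF component_module]

lemma vectorspace_family_sum: "vectorspace K (family_sum I M)"
proof -
  note simps = carrier_family_sum[OF I] family_sum_simps
  show ?thesis
  proof (rule vs_criteria)
    show "\<forall>v\<in>carrier (family_sum I M). \<exists>w\<in>carrier (family_sum I M).
        v \<oplus>\<^bsub>family_sum I M\<^esub> w = \<zero>\<^bsub>family_sum I M\<^esub>"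
    proof
      fix v assume "v \<in> carrier (family_sum I M)"
      then show "\<exists>w\<in>carrier (family_sum I M). v \<oplus>\<^bsub>family_sum I M\<^esub> w = \<zero>\<^bsub>family_sum I M\<^esub>"
        by (intro bexI[of _ "\<lambda>i\<in>I. \<ominus>\<^bsub>M i\<^esub> v i"])
          (auto simp: simps fun_eq_iff components PiE_iff)
    qed
  qed (auto simp: K simps fun_eq_iff PiE_iff extensional_def components)
qed

lemma linear_map_family_single:
  assumes j: "j \<in> I"
  shows "linear_map K (M j) (family_sum I M) (family_single I M j)"
  by (rule linear_mapI[OF M[OF j] vectorspace_family_sum])
    (auto simp: family_single_def carrier_family_sum[OF I] family_sum_simps fun_eq_iff j components)

text \<open>Finite spanning sets of the summands, moved into the sum by the canonical injections,
  together form a finite spanning set.\<close>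

lemma fin_dim_family_sum:
  assumes fd: "\<And>i. i \<in> I \<Longrightarrow> vectorspace.fin_dim K (M i)"
  shows "vectorspace.fin_dim K (family_sum I M)"
proof -
  interpret S: vectorspace K "family_sum I M" by (rule vectorspace_family_sum)
  note simps = carrier_family_sum[OF I] family_sum_simps
  have "\<forall>i\<in>I. \<exists>B. finite B \<and> B \<subseteq> carrier (M i) \<and> module.span K (M i) B = carrier (M i)"
    using fd vectorspace.fin_dim_def[OF M] by metis
  then obtain B where B: "\<And>i. i \<in> I \<Longrightarrow> finite (B i)" "\<And>i. i \<in> I \<Longrightarrow> B i \<subseteq> carrier (M i)"
    "\<And>i. i \<in> I \<Longrightarrow> module.span K (M i) (B i) = carrier (M i)" by metis
  define G where "G = (\<Union>i\<in>I. family_single I M i ` B i)"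
  have G: "finite G" "G \<subseteq> carrier (family_sum I M)"
    using I B(1) subsetD[OF B(2)]
    by (auto simp: G_def family_single_def carrier_family_sum[OF I] components)
  interpret sp: submodule K "S.span G" "family_sum I M" by (rule S.span_is_submodule[OF G(2)])
  have single: "family_single I M i y \<in> S.span G" if "i \<in> I" "y \<in> carrier (M i)" for i y
  proof -
    have "family_single I M i y \<in> S.span (family_single I M i ` B i)"
      using linear_map.image_span_subset[OF linear_map_family_single[OF that(1)] B(2)[OF that(1)]]
        B(3)[OF that(1)] that(2) by blast
    also have "\<dots> \<subseteq> S.span G" using that(1) by (intro S.span_is_monotone) (auto simp: G_def)
    finally show ?thesis .
  qed
  \<comment> \<open>Induction on a set \<open>J\<close> containing the support of \<open>x\<close>:
    the component at a new index \<open>j\<close> is split off, and the rest \<open>?y\<close> is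
    supported in the smaller set. The case \<open>J = I\<close> covers all vectors.\<close>
  have "x \<in> S.span G" if "J \<subseteq> I" "x \<in> carrier (family_sum I M)" "\<forall>i\<in>I - J. x i = \<zero>\<^bsub>M i\<^esub>" for J x
    using finite_subset[OF that(1) I] that
  proof (induction J arbitrary: x rule: finite_induct)
    case empty
    then have "x = \<zero>\<^bsub>family_sum I M\<^esub>" by (auto simp: simps fun_eq_iff PiE_def extensional_def)
    then show ?case by simp
  next
    case (insert j J)
    let ?y = "\<lambda>i\<in>I. if i = j then \<zero>\<^bsub>M i\<^esub> else x i"
    have xi: "x i \<in> carrier (M i)" if "i \<in> I" for i
      using insert.prems(2) that by (auto simp: simps)
    have "?y \<in> S.span G" using insert.prems xi by (intro insert.IH) (auto simp: simps components)
    moreover have "family_single I M j (x j) \<in> S.span G" using insert.prems(1) xi by (intro single) auto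
    moreover have "x = family_single I M j (x j) \<oplus>\<^bsub>family_sum I M\<^esub> ?y"
      using insert.prems(2) xi by (auto simp: simps family_single_def fun_eq_iff PiE_def extensional_def components)
    ultimately show ?case using sp.m_closed by metis
  qed
  from this[of I] have "S.span G = carrier (family_sum I M)" using sp.subset by auto
  then show ?thesis using G by (auto simp: S.fin_dim_def)
qed

end

section \<open>Sheaf cohomology\<close>

text \<open>Linearity is checked edge by edge, where it follows from that of the two restriction
  maps. The \<epsilon> are treated as arbitrary scalars of \<open>K\<close>.\<close>

lemma (in cellular_sheaf) linear_map_coboundary:
  assumes K: "field K" and \<epsilon>: "\<And>e. e \<in> arcs G \<Longrightarrow> \<epsilon> e \<in> carrier K"
  shows "linear_map K (cochains0 G F) (cochains1 G F) (coboundary G F \<epsilon>)"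
proof -
  interpret K: field K by (rule K)
  \<comment> \<open>The component at \<open>e\<close>, with the values at head and tail as separate
    arguments; a loop receives the same value twice.\<close>
  define \<delta> where "\<delta> e x y = \<epsilon> e \<odot>\<^bsub>edge_stalk F e\<^esub> (restr_head F e x \<ominus>\<^bsub>edge_stalk F e\<^esub> restr_tail F e y)"
    for e x y
  have edge: "\<delta> e x y \<in> carrier (edge_stalk F e)"
    "a \<in> carrier K \<Longrightarrow> \<delta> e (a \<odot>\<^bsub>vertex_stalk F (head G e)\<^esub> x) (a \<odot>\<^bsub>vertex_stalk F (tail G e)\<^esub> y) =
      a \<odot>\<^bsub>edge_stalk F e\<^esub> \<delta> e x y"
    "\<delta> e (x \<oplus>\<^bsub>vertex_stalk F (head G e)\<^esub> x') (y \<oplus>\<^bsub>vertex_stalk F (tail G e)\<^esub> y') =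
      \<delta> e x y \<oplus>\<^bsub>edge_stalk F e\<^esub> \<delta> e x' y'"
    if e: "e \<in> arcs G"
      and x: "x \<in> carrier (vertex_stalk F (head G e))" "x' \<in> carrier (vertex_stalk F (head G e))"
      and y: "y \<in> carrier (vertex_stalk F (tail G e))" "y' \<in> carrier (vertex_stalk F (tail G e))"
    for e x x' y y' a
  proof -
    interpret h: linear_map K "vertex_stalk F (head G e)" "edge_stalk F e" "restr_head F e"
      by (rule linear_restr_head[OF e])
    interpret t: linear_map K "vertex_stalk F (tail G e)" "edge_stalk F e" "restr_tail F e"
      by (rule linear_restr_tail[OF e])
    show "\<delta> e x y \<in> carrier (edge_stalk F e)"
      using x y \<epsilon>[OF e] by (simp add: \<delta>_def)
    show "\<delta> e (a \<odot>\<^bsub>vertex_stalk F (head G e)\<^esub> x) (a \<odot>\<^bsub>vertex_stalk F (tail G e)\<^esub> y) =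
        a \<odot>\<^bsub>edge_stalk F e\<^esub> \<delta> e x y" if a: "a \<in> carrier K"
      \<comment> \<open>Commutativity of \<open>K\<close> lets \<open>a\<close> pass the factor
        \<open>\<epsilon> e\<close>.\<close>
      using x y a \<epsilon>[OF e]
      by (simp add: \<delta>_def a_minus_def h.W.module.smult_r_distr h.W.module.smult_r_minus
          h.W.module.smult_assoc1[symmetric] K.m_comm)
    show "\<delta> e (x \<oplus>\<^bsub>vertex_stalk F (head G e)\<^esub> x') (y \<oplus>\<^bsub>vertex_stalk F (tail G e)\<^esub> y') =
        \<delta> e x y \<oplus>\<^bsub>edge_stalk F e\<^esub> \<delta> e x' y'"
      using x y \<epsilon>[OF e]
      by (simp add: \<delta>_def a_minus_def h.W.module.smult_r_distr h.W.module.smult_r_minus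
          h.W.module.M.minus_add h.W.module.M.a_ac)
  qed
  note simps = cochains0_def cochains1_def carrier_family_sum[OF finite_verts]
    carrier_family_sum[OF finite_arcs] family_sum_simps coboundary_def \<delta>_def[symmetric]
  have mem: "x (head G e) \<in> carrier (vertex_stalk F (head G e))"
    "x (tail G e) \<in> carrier (vertex_stalk F (tail G e))"
    if "x \<in> carrier (cochains0 G F)" "e \<in> arcs G" for x e
    using that by (auto simp: simps)
  show ?thesis
  proof (rule linear_mapI)
    show "vectorspace K (cochains0 G F)" unfolding cochains0_def
      by (rule vectorspace_family_sum[OF K finite_verts vectorspace_vertex_stalk])
    show "vectorspace K (cochains1 G F)" unfolding cochains1_def
      by (rule vectorspace_family_sum[OF K finite_arcs vectorspace_edge_stalk])
    fix x assume x: "x \<in> carrier (cochains0 G F)"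
    show "coboundary G F \<epsilon> x \<in> carrier (cochains1 G F)"
      \<comment> \<open>The facts \<open>edge\<close> speak of two pairs of end values; here and for
        scalars one cochain supplies both pairs.\<close>
      using edge(1)[OF _ mem(1)[OF x] mem(1)[OF x] mem(2)[OF x] mem(2)[OF x]] by (auto simp: simps)
    show "coboundary G F \<epsilon> (a \<odot>\<^bsub>cochains0 G F\<^esub> x) = a \<odot>\<^bsub>cochains1 G F\<^esub> coboundary G F \<epsilon> x"
      if "a \<in> carrier K" for a
      using edge(2)[OF _ mem(1)[OF x] mem(1)[OF x] mem(2)[OF x] mem(2)[OF x]] that by (auto simp: simps fun_eq_iff)
    show "coboundary G F \<epsilon> (x \<oplus>\<^bsub>cochains0 G F\<^esub> y) =
        coboundary G F \<epsilon> x \<oplus>\<^bsub>cochains1 G F\<^esub> coboundary G F \<epsilon> y"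
      if y: "y \<in> carrier (cochains0 G F)" for y
      using edge(3)[OF _ mem(1)[OF x] mem(1)[OF y] mem(2)[OF x] mem(2)[OF y]] by (auto simp: simps fun_eq_iff)
  qed
qed

text \<open>The sets \<open>in_arcs G v\<close> partition the edges by their heads, so a family
  indexed by vertices and then by incoming edges is a regrouped family indexed by edges.\<close>

lemma (in network_coding_sheaf) vertex_stalks_isomorphic_edge_stalks:
  "vs_isomorphic class_ring
    (family_sum (verts G) (vertex_stalk F)) (family_sum (arcs G) (edge_stalk F))"
proof -
  \<comment> \<open>The summand of \<open>e\<close> sits in the stalk at its head, where
    \<open>?f\<close> reads it; \<open>?g\<close> collects the entries again by head.\<close>
  let ?f = "\<lambda>x. \<lambda>e\<in>arcs G. x (head G e) e"
  let ?g = "\<lambda>y. \<lambda>v\<in>verts G. \<lambda>e\<in>in_arcs G v. y e"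
  note simps = carrier_family_sum[OF finite_verts] carrier_family_sum[OF finite_arcs]
    carrier_family_sum[OF finite_in_arcs] family_sum_simps vertex_stalk_eq edge_stalk_eq
  have mem: "x (head G e) e \<in> carrier (module_vec TYPE('k) (c e))"
    if "x \<in> carrier (family_sum (verts G) (vertex_stalk F))" "e \<in> arcs G" for x e
  proof -
    have "x (head G e) \<in> carrier (vertex_stalk F (head G e))" using that by (auto simp: simps(1))
    then show ?thesis using that(2) by (auto simp: simps)
  qed
  have K: "field (class_ring :: 'k ring)" by (rule class_field)
  have "linear_map class_ring (family_sum (verts G) (vertex_stalk F)) (family_sum (arcs G) (edge_stalk F)) ?f"
    by (rule linear_mapI[OF vectorspace_family_sum[OF K finite_verts vectorspace_vertex_stalk]
          vectorspace_family_sum[OF K finite_arcs vectorspace_edge_stalk]])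
      (use mem in \<open>auto simp: simps fun_eq_iff\<close>)
  moreover have "bij_betw ?f (carrier (family_sum (verts G) (vertex_stalk F)))
      (carrier (family_sum (arcs G) (edge_stalk F)))"
  proof (rule bij_betw_byWitness[where f' = ?g])
    show "\<forall>x\<in>carrier (family_sum (verts G) (vertex_stalk F)). ?g (?f x) = x"
      by (auto simp: simps fun_eq_iff PiE_def Pi_def extensional_def)
  qed (auto simp: simps fun_eq_iff PiE_def Pi_def extensional_def)
  ultimately show ?thesis by (auto simp: vs_isomorphic_def)
qed

theorem proposition9p1p4:
  fixes G :: "('v, 'e) pre_digraph"
    and c :: "'e \<Rightarrow> nat"
    and F :: "('v, 'e, 'k :: field, 'e \<Rightarrow> 'k vec, 'k vec) graph_sheaf"
    and \<epsilon> :: "'e \<Rightarrow> 'k"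
  assumes "network_coding_sheaf G c F"
    and "\<And>e. e \<in> arcs G \<Longrightarrow> \<epsilon> e \<in> {1, - 1}"
  shows "vs_isomorphic class_ring
           (family_sum (verts G) (vertex_stalk F)) (family_sum (arcs G) (edge_stalk F))
       \<and> vs_isomorphic class_ring (cohomology0 G F \<epsilon>) (cohomology1 G F \<epsilon>)"
proof -
  interpret network_coding_sheaf G c F by (rule assms(1))
  have K: "field (class_ring :: 'k ring)" by (rule class_field)
  interpret d: linear_map class_ring "cochains0 G F" "cochains1 G F" "coboundary G F \<epsilon>"
    \<comment> \<open>Each \<open>\<epsilon> e\<close> lies in the carrier of
      \<open>class_ring\<close>, which is the whole type.\<close>
    by (rule linear_map_coboundary[OF K]) simp
  have iso: "vs_isomorphic class_ring (cochains0 G F) (cochains1 G F)"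
    using vertex_stalks_isomorphic_edge_stalks by (simp add: cochains0_def cochains1_def)
  have fd: "vectorspace.fin_dim class_ring (edge_stalk F e)" if "e \<in> arcs G" for e
    using vec_space.fin_dim[where 'a = 'k and n = "c e"] that by (simp add: edge_stalk_eq)
  have "d.W.fin_dim" unfolding cochains1_def
    by (rule fin_dim_family_sum[OF K finite_arcs vectorspace_edge_stalk fd])
  \<comment> \<open>Finite dimension is proved for the edge cochains, a single sum of spaces of
    vectors of length \<open>c e\<close>, and pulled back along the first isomorphism.\<close>
  then have "d.V.fin_dim"
    by (rule vs_isomorphic_fin_dim[OF vs_isomorphic_sym[OF iso]])
  then have "vs_isomorphic class_ring (cohomology0 G F \<epsilon>) (cohomology1 G F \<epsilon>)"
    \<comment> \<open>Unfolded, the two cohomology spaces are literally the kernel as a subspace and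
      the quotient by the image.\<close>
    unfolding cohomology0_def cohomology1_def by (rule d.ker_isomorphic_coker[OF _ iso])
  then show ?thesis using vertex_stalks_isomorphic_edge_stalks by blast
qed

end
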